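(* Let $(a,b,c)$ be a triple of positive integers with $a=b+c-1$, $a\geq c\geq b$, and $b$ and $c$ relatively prime. Then $(a,b,c)$ is a good triple.
   Context: For positive integers $a,b,c$ with $n=a+b+c$, the permutation of the triple $(a,b,c)$ is the permutation of $[n]$ with $p_i=n+1-i$ for $1\le i\le a$, $p_i=a+b+1-i$ for $a+1\le i\le a+b$, and $p_i=n+b+1-i$ for $a+b+1\le i\le n$ (one-line notation $n\cdots(n-a+1)\ b\cdots1\ (b+c)\cdots(b+1)$). The triple is good if this permutation, as a bijection $i\mapsto p_i$ of $[n]$, is a single $n$-cycle. *)

theory Defs
  imports "HOL-Combinatorics.Combinatorics"
begin

text \<open>Outside \<open>{1..a+b+c}\<close> the permutation is extended by the identity, as for \<open>permutes\<close>.
  No natural-number subtraction below is truncated.\<close>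

definition triple_perm :: "nat \<Rightarrow> nat \<Rightarrow> nat \<Rightarrow> nat \<Rightarrow> nat" where
  "triple_perm a b c i =
    (let n = a + b + c in
     if 1 \<le> i \<and> i \<le> a then n + 1 - i
     else if a + 1 \<le> i \<and> i \<le> a + b then a + b + 1 - i
     else if a + b + 1 \<le> i \<and> i \<le> n then n + b + 1 - i
     else i)"

lemma triple_perm_permutes: "triple_perm a b c permutes {1..a + b + c}"
proof (rule bij_imp_permutes)
  have inj: "inj_on (triple_perm a b c) {1..a + b + c}"
    by (rule inj_onI) (auto simp: triple_perm_def Let_def split: if_splits)
  have "triple_perm a b c ` {1..a + b + c} \<subseteq> {1..a + b + c}"
    by (auto simp: triple_perm_def Let_def)
  with inj show "bij_betw (triple_perm a b c) {1..a + b + c} {1..a + b + c}"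
    by (simp add: bij_betw_def endo_inj_surj)
qed (auto simp: triple_perm_def Let_def)

text \<open>\<open>cyclic_on f S\<close> says that \<open>S\<close> is a single orbit of \<open>f\<close>; for a permutation of
  \<open>{1..n}\<close> this means being one \<open>n\<close>-cycle.\<close>

definition good_triple :: "nat \<Rightarrow> nat \<Rightarrow> nat \<Rightarrow> bool" where
  "good_triple a b c \<longleftrightarrow> cyclic_on (triple_perm a b c) {1..a + b + c}"

end

theory Submission
  imports Defs "HOL-Number_Theory.Cong"
begin

text \<open>
  Put \<open>m = b + c\<close>, so that \<open>a = m - 1\<close> and \<open>n = 2 * m - 1\<close>. The permutation maps \<open>{1..<m}\<close> onto
  \<open>{m<..n}\<close> and maps \<open>m\<close> to \<open>b\<close>; its square sends \<open>i < m\<close> to \<open>i + b\<close> if \<open>i \<le> c\<close> and to \<open>i - c\<close>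
  otherwise. Hence the first return map to \<open>{1..m}\<close> is the rotation by \<open>b\<close> modulo \<open>m\<close>, which is
  a single cycle because \<open>b\<close> and \<open>m\<close> are coprime.
\<close>

text \<open>Each return to \<open>{1..b + c}\<close> adds \<open>b\<close> modulo
  \<open>b + c\<close>, so induction on \<open>k\<close> follows the returns of
  \<open>b + c\<close>, whose residue is 0. The factor is \<open>Suc k\<close> because
  \<open>orbit\<close> only collects points reached by at least one application.\<close>

lemma multiple_in_orbit_triple_perm:
  fixes b c j k :: nat
  assumes "b > 0" and "c > 0" and "j \<in> {1..b + c}" and "[j = Suc k * b] (mod (b + c))"
  shows "j \<in> orbit (triple_perm (b + c - 1) b c) (b + c)"
  using assms(3,4)
proof (induction k arbitrary: j)
  let ?f = "triple_perm (b + c - 1) b c" and ?m = "b + c"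
  have f_m: "?f ?m = b"
    using assms(1,2) by (auto simp: triple_perm_def Let_def)
  {
    case 0
    have "j = b"
    proof (cases "j = ?m")
      case True
      with 0 assms(1,2) show ?thesis
        by (simp add: cong_def)
    next
      case False
      with 0 assms(1,2) show ?thesis
        by (simp add: cong_def)
    qed
    with f_m show ?case
      by (metis orbit.base)
  next
    case (Suc k)
    \<comment> \<open>The predecessor of \<open>j\<close> under the rotation: \<open>j - b\<close>
      modulo \<open>b + c\<close>, taken in \<open>{1..b + c}\<close>.\<close>
    define i where "i = (if j > b then j - b else j + c)"
    have i: "i \<in> {1..?m}"
      using Suc.prems(1) assms(1,2) by (auto simp: i_def)
    have "[i + b = j] (mod ?m)"
      by (auto simp: i_def cong_def add.assoc add.commute[of c b])
    then have "[i + b = Suc k * b + b] (mod ?m)"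
      using Suc.prems(2) by (auto simp: cong_def add.commute)
    then have "[i = Suc k * b] (mod ?m)"
      by (simp only: cong_add_rcancel_nat)
    with i have orb: "i \<in> orbit ?f ?m"
      by (rule Suc.IH)
    show ?case
    proof (cases "i = ?m")
      case True
      then have "j = b"
        using Suc.prems(1) assms(1,2) by (auto simp: i_def split: if_splits)
      with f_m show ?thesis
        by (metis orbit.base)
    next
      case False
      with i have f_i: "?f i = 2 * ?m - i"
        by (auto simp: triple_perm_def Let_def)
      \<comment> \<open>The point \<open>2 * ?m - i\<close> lies in the third block if
        \<open>i \<le> c\<close>, that is \<open>j > b\<close>, and in the second block
        otherwise.\<close>
      have "?f (2 * ?m - i) = j"
      proof (cases "j > b")
        case True
        then have "j = i + b" and "i \<le> c"
          using Suc.prems(1) by (auto simp: i_def)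
        with i show ?thesis
          by (auto simp: triple_perm_def Let_def)
      next
        case False
        then have i_eq: "i = j + c" and "j < b"
          using \<open>i \<noteq> ?m\<close> by (auto simp: i_def)
        with Suc.prems(1) have "2 * ?m - i = ?m + (b - j)" and "b - (b - j) = j"
          by auto
        with \<open>j < b\<close> Suc.prems(1) show ?thesis
          by (auto simp: triple_perm_def Let_def)
      qed
      with f_i have "?f (?f i) = j"
        by (simp only:)
      with orb show ?thesis
        by (metis orbit.step)
    qed
  }
qed

lemma atLeastAtMost_subset_orbit_triple_perm:
  fixes b c :: nat
  assumes "b > 0" and "c > 0" and "coprime b c"
  shows "{1..b + c} \<subseteq> orbit (triple_perm (b + c - 1) b c) (b + c)"
proof
  fix j assume j: "j \<in> {1..b + c}"
  have "coprime b (b + c)"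
    using assms(3) by (simp add: coprime_iff_gcd_eq_1)
  then obtain x where "[b * x = 1] (mod (b + c))"
    using cong_solve_coprime_nat by auto
  \<comment> \<open>The factor sought is a successor, so \<open>j - b\<close> must be a multiple of
    \<open>b\<close>; \<open>j + c\<close> represents it without subtraction.\<close>
  then have "[b * x * (j + c) = 1 * (j + c)] (mod (b + c))"
    by (rule cong_scalar_right)
  then have "[(x * (j + c)) * b + b = (j + c) + b] (mod (b + c))"
    by (intro cong_add) (simp_all add: ac_simps)
  moreover have "[(j + c) + b = j] (mod (b + c))"
    by (simp add: cong_def add.assoc add.commute[of c b])
  ultimately have "[j = Suc (x * (j + c)) * b] (mod (b + c))"
    by (simp add: cong_def add.commute)
  with assms(1,2) j show "j \<in> orbit (triple_perm (b + c - 1) b c) (b + c)"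
    by (rule multiple_in_orbit_triple_perm)
qed

theorem theorem12:
  fixes a b c :: nat
  assumes "a > 0" and "b > 0" and "c > 0"
    and "a = b + c - 1"
    and "a \<ge> c" and "c \<ge> b"
    and "coprime b c"
  shows "good_triple a b c"
proof -
  let ?f = "triple_perm a b c" and ?m = "b + c"
  have low: "{1..?m} \<subseteq> orbit ?f ?m"
    using atLeastAtMost_subset_orbit_triple_perm[OF assms(2,3,7)] assms(4) by simp
  have "{1..a + b + c} \<subseteq> orbit ?f ?m"
  proof
    fix j assume j: "j \<in> {1..a + b + c}"
    show "j \<in> orbit ?f ?m"
    proof (cases "j \<le> ?m")
      case True
      with j low show ?thesis by auto
    next
      case False
      \<comment> \<open>Points above \<open>?m\<close> are the images of the first block, which is
        reflected onto them.\<close>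
      then have "?f (2 * ?m - j) = j" and "2 * ?m - j \<in> {1..?m}"
        using j assms(2-4) by (auto simp: triple_perm_def Let_def)
      with low show ?thesis
        by (metis orbit.step subsetD)
    qed
  qed
  moreover have m: "?m \<in> {1..a + b + c}"
    using assms(2) by simp
  ultimately have "{1..a + b + c} = orbit ?f ?m"
    using permutes_orbit_subset[OF triple_perm_permutes m] by blast
  with m show ?thesis
    unfolding good_triple_def cyclic_on_def by blast
qed

end
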